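(* Let $(G_n)_{n\ge 0}$ be the sequence of graphs defined in the context, let $T_n(x,y)=T(G_n;x,y)$ be the Tutte polynomial of $G_n$, and let $\tau(G_n)$ be the number of spanning trees of $G_n$. The number of spanning trees of $G_n$ is given by $$\tau(G_n)=T_n(1,1)=8^{\frac{4^n-1}{3}}=2^{4^n-1},$$ and the asymptotic growth constant is $$\lim_{n\to\infty}\frac{\ln\tau(G_n)}{|V(G_n)|}=\frac{3}{2}\ln 2\;(\approx 1.0397).$$
   Context: Tutte polynomial: for a graph $G$ with vertex set $V(G)$, edge set $E(G)$ and $k(G)$ connected components, put $r(G)=|V(G)|-k(G)$ and $n(G)=|E(G)|-|V(G)|+k(G)$. Then $T(G;x,y)=\sum_{H\subseteq G}(x-1)^{r(G)-r(H)}(y-1)^{n(H)}$, where the sum runs over all spanning subgraphs $H$ of $G$ (subgraphs with $V(H)=V(G)$ and arbitrary $E(H)\subseteq E(G)$). For a connected graph $G$, $T(G;1,1)=\tau(G)$ is the number of spanning trees of $G$. The graphs $G_n$: $G_0$ is the complete graph $K_2$ with its two vertices denoted $X_0,Y_0$. For $n\ge 0$, given $G_n$ with two special vertices $X_n,Y_n$, take four disjoint copies $G_n^1,G_n^2,G_n^3,G_n^4$ of $G_n$, with special vertices $X_n^i,Y_n^i$. Identify $X_n^1$ with $X_n^2$ to form the special vertex $X_{n+1}$ of $G_{n+1}$; identify $Y_n^3$ with $Y_n^4$ to form the special vertex $Y_{n+1}$ of $G_{n+1}$; identify $Y_n^1$ with $X_n^3$ to form a vertex $a$, and $Y_n^2$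 with $X_n^4$ to form a vertex $b$; finally add a new edge $e_n$ joining $a$ and $b$. The result is $G_{n+1}$. *)

theory Defs
  imports Complex_Main
begin

section \<open>Graphs\<close>

text \<open>
  Undirected multigraphs as vertices and edges with an incidence map that sends an edge to the set
  of its end vertices (a singleton for a loop). Edges are objects of their own, so that identifying
  vertices can never merge two edges into one.
\<close>

record ('v, 'e) graph =
  verts :: "'v set"
  edges :: "'e set"
  ends :: "'e \<Rightarrow> 'v set"

definition wf_graph :: "('v, 'e) graph \<Rightarrow> bool" where
  "wf_graph G \<longleftrightarrow> finite (verts G) \<and> finite (edges G) \<and>
     (\<forall>e\<in>edges G. ends G e \<subseteq> verts G \<and> card (ends G e) \<in> {1, 2})"

definition adjacency :: "('v, 'e) graph \<Rightarrow> 'v rel" where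
  "adjacency G = {(u, v). \<exists>e\<in>edges G. ends G e = {u, v}}"

definition graph_components :: "('v, 'e) graph \<Rightarrow> 'v set set" where
  "graph_components G = verts G // (adjacency G)\<^sup>*"

definition num_components :: "('v, 'e) graph \<Rightarrow> nat" where
  "num_components G = card (graph_components G)"

definition graph_rank :: "('v, 'e) graph \<Rightarrow> nat" where
  "graph_rank G = card (verts G) - num_components G"

text \<open>
  The order of the summands below matters for the truncated subtraction on natural numbers:
  the number of edges plus the number of components is never smaller than the number of vertices,
  so no truncation takes place.
\<close>

definition nullity :: "('v, 'e) graph \<Rightarrow> nat" where
  "nullity G = card (edges G) + num_components G - card (verts G)"

definition spanning_subgraphs :: "('v, 'e) graph \<Rightarrow> ('v, 'e) graph set" where
  "spanning_subgraphs G = (\<lambda>A. G\<lparr>edges := A\<rparr>) ` Pow (edges G)"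

text \<open>The Tutte polynomial, given by its values over an arbitrary commutative ring.\<close>

definition tutte :: "('v, 'e) graph \<Rightarrow> 'a::comm_ring_1 \<Rightarrow> 'a \<Rightarrow> 'a" where
  "tutte G x y =
     (\<Sum>H\<in>spanning_subgraphs G. (x - 1) ^ (graph_rank G - graph_rank H) * (y - 1) ^ nullity H)"

definition connected_graph :: "('v, 'e) graph \<Rightarrow> bool" where
  "connected_graph G \<longleftrightarrow>
     verts G \<noteq> {} \<and> (\<forall>u\<in>verts G. \<forall>v\<in>verts G. (u, v) \<in> (adjacency G)\<^sup>*)"

text \<open>
  A cycle is a cyclic sequence of distinct vertices joined by distinct edges. Loops are cycles of
  length 1, and pairs of parallel edges are cycles of length 2.
\<close>

definition is_cycle :: "('v, 'e) graph \<Rightarrow> 'v list \<Rightarrow> 'e list \<Rightarrow> bool" where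
  "is_cycle G vs es \<longleftrightarrow>
     vs \<noteq> [] \<and> length es = length vs \<and> distinct vs \<and> distinct es \<and>
     set vs \<subseteq> verts G \<and> set es \<subseteq> edges G \<and>
     (\<forall>i<length vs. ends G (es ! i) = {vs ! i, vs ! (Suc i mod length vs)})"

definition is_tree :: "('v, 'e) graph \<Rightarrow> bool" where
  "is_tree G \<longleftrightarrow> connected_graph G \<and> (\<nexists>vs es. is_cycle G vs es)"

definition num_spanning_trees :: "('v, 'e) graph \<Rightarrow> nat" where
  "num_spanning_trees G = card {H \<in> spanning_subgraphs G. is_tree H}"


section \<open>The recursively constructed graphs\<close>

datatype copy = C1 | C2 | C3 | C4

datatype vertex = X0 | Y0 | VCopy copy vertex

datatype edge = E0 | ECopy copy edge | ENew

text \<open>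
  The disjoint union of four copies of a vertex set is modelled by pairs \<open>(i, v)\<close>. For special
  vertices \<open>X\<close> and \<open>Y\<close>, the four identifications of the construction are the pairs in
  \<open>identified X Y\<close>. The map \<open>glue X Y\<close> sends \<open>(i, v)\<close> to the chosen representative of its class in
  the quotient; lemma \<open>glue_eq_iff\<close> below states that it identifies exactly what it should.
\<close>

definition identified :: "vertex \<Rightarrow> vertex \<Rightarrow> (copy \<times> vertex) rel" where
  "identified X Y =
     {((C1, X), (C2, X)), ((C3, Y), (C4, Y)), ((C1, Y), (C3, X)), ((C2, Y), (C4, X))}"

definition glue :: "vertex \<Rightarrow> vertex \<Rightarrow> copy \<Rightarrow> vertex \<Rightarrow> vertex" where
  "glue X Y i v =
     (if i = C2 \<and> v = X then VCopy C1 X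
      else if i = C4 \<and> v = Y then VCopy C3 Y
      else if i = C3 \<and> v = X then VCopy C1 Y
      else if i = C4 \<and> v = X then VCopy C2 Y
      else VCopy i v)"

text \<open>The special vertices of the \<open>n\<close>-th graph.\<close>

fun spX :: "nat \<Rightarrow> vertex" and spY :: "nat \<Rightarrow> vertex" where
  "spX 0 = X0"
| "spY 0 = Y0"
| "spX (Suc n) = glue (spX n) (spY n) C1 (spX n)"
| "spY (Suc n) = glue (spX n) (spY n) C3 (spY n)"

primrec Gn :: "nat \<Rightarrow> (vertex, edge) graph" where
  "Gn 0 = \<lparr>verts = {X0, Y0}, edges = {E0}, ends = (\<lambda>_. {X0, Y0})\<rparr>"
| "Gn (Suc n) =
     (let g = glue (spX n) (spY n); a = g C1 (spY n); b = g C2 (spY n) in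
      \<lparr>verts = (\<Union>i. g i ` verts (Gn n)),
       edges = insert ENew (\<Union>i. ECopy i ` edges (Gn n)),
       ends = (\<lambda>e. case e of ECopy i e' \<Rightarrow> g i ` ends (Gn n) e' | _ \<Rightarrow> {a, b})\<rparr>)"

lemma spX_neq_spY: "spX n \<noteq> spY n"
  by (induction n) (auto simp: glue_def)

lemma glue_eq_iff:
  assumes "X \<noteq> Y"
  shows "glue X Y i u = glue X Y j v \<longleftrightarrow>
    ((i, u), (j, v)) \<in> (identified X Y \<union> (identified X Y)\<inverse>)\<^sup>*" (is "_ \<longleftrightarrow> _ \<in> ?R\<^sup>*")
proof
  define rep where "rep = (\<lambda>w. case w of VCopy i v \<Rightarrow> (i, v) | _ \<Rightarrow> (C1, X))"
  have sym: "(p, q) \<in> ?R\<^sup>* \<Longrightarrow> (q, p) \<in> ?R\<^sup>*" for p q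
    by (metis sym_Un_converse sym_rtrancl symD)
  have toR: "((i, u), rep (glue X Y i u)) \<in> ?R\<^sup>*" for i u
  proof -
    have "((i, u), rep (glue X Y i u)) \<in> ?R\<^sup>="
      using assms by (auto simp: rep_def glue_def identified_def)
    then show ?thesis by auto
  qed
  show "glue X Y i u = glue X Y j v \<Longrightarrow> ((i, u), (j, v)) \<in> ?R\<^sup>*"
    using toR[of i u] sym[OF toR[of j v]] by (metis rtrancl_trans)
next
  have step: "case_prod (glue X Y) p = case_prod (glue X Y) q" if "(p, q) \<in> ?R" for p q
    using that assms by (auto simp: glue_def identified_def)
  assume "((i, u), (j, v)) \<in> ?R\<^sup>*"
  then have "case_prod (glue X Y) (i, u) = case_prod (glue X Y) (j, v)"
    by (induction rule: rtrancl_induct) (use step in auto)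
  then show "glue X Y i u = glue X Y j v" by simp
qed

lemma UNIV_copy: "(UNIV :: copy set) = {C1, C2, C3, C4}"
  using copy.exhaust by blast

lemma special_in_verts: "spX n \<in> verts (Gn n)" "spY n \<in> verts (Gn n)"
  by (induction n) (auto simp: Let_def)

lemma wf_Gn: "wf_graph (Gn n)"
proof (induction n)
  case 0
  show ?case by (simp add: wf_graph_def)
next
  case (Suc n)
  let ?g = "glue (spX n) (spY n)"
  have inj: "inj (?g i)" for i
    using spX_neq_spY[of n] by (auto simp: inj_def glue_def split: if_splits)
  have "card (?g i ` A) = card A" for i A
    using inj by (meson card_image inj_on_subset subset_UNIV)
  moreover have "?g C1 (spY n) \<noteq> ?g C2 (spY n)"
    using spX_neq_spY[of n] by (auto simp: glue_def)
  ultimately show ?case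
    using Suc special_in_verts(2)[of n] unfolding wf_graph_def
    by (fastforce simp: Let_def UNIV_copy)
qed

text \<open>The natural-number division in \<open>(4 ^ n - 1) div 3\<close> is exact:\<close>

lemma three_dvd: "3 dvd 4 ^ n - (1::nat)"
proof (induction n)
  case (Suc n)
  have "4 ^ Suc n - (1::nat) = 3 * 4 ^ n + (4 ^ n - 1)" by simp
  then show ?case using Suc by (metis dvd_add dvd_triv_left)
qed simp

end

theory Submission
  imports Defs "HOL-Library.FuncSet" "HOL-Analysis.Harmonic_Numbers"
begin

text \<open>
  For \<open>G\<^sub>n\<close> count both the spanning trees and the two-component spanning forests that separate the
  special vertices. In the glued graph, a tree or separating forest restricts on each copy to one of these two kinds, and replacing a copy
  by an edge (tree) or a non-edge (forest) yields a spanning tree, or a separating forest, of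
  \<open>K\<^sub>4\<close> minus an edge. There are eight of each, so the two numbers coincide for all \<open>n\<close> and
  satisfy \<open>t\<^sub>n\<^sub>+\<^sub>1 = 8 t\<^sub>n\<^sup>4\<close>.
\<close>

section \<open>Connectivity in multigraphs\<close>

text \<open>Acyclicity is not local under gluing: a cycle may run through several copies. Edge
  counts are local. Both kinds of edge set are therefore described without cycles, by which vertices
  reach the special ones and by having the fewest edges that this allows. Cycles are needed only to
  match the given notion of a tree. If \<open>t\<close> and \<open>f\<close> are the two counts for
  one copy, a pattern with \<open>k\<close> of the four copy edges contributes
  \<open>t^k f^(4-k)\<close>, so in general there would be two coupled recursions. They collapse to
  one because \<open>t = f = 1\<close> holds for the single edge and the two pattern counts agree.
  Connectivity takes an incidence map and an edge set instead of a graph, so that the same notions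
  serve the graphs, the parts of an edge set and the pattern, whose edges have another type.\<close>

definition conn :: "('e \<Rightarrow> 'v set) \<Rightarrow> 'e set \<Rightarrow> 'v rel" where
  "conn en A = {(u, v). \<exists>e\<in>A. en e = {u, v}}\<^sup>*"

lemma adjacency_rtrancl: "(adjacency H)\<^sup>* = conn (ends H) (edges H)"
  by (simp add: adjacency_def conn_def)

lemma conn_refl [simp]: "(u, u) \<in> conn en A"
  by (simp add: conn_def)

lemma conn_sym: "(u, v) \<in> conn en A \<Longrightarrow> (v, u) \<in> conn en A"
proof -
  have "sym {(u, v). \<exists>e\<in>A. en e = {u, v}}"
    by (auto simp: sym_def insert_commute)
  then show "(u, v) \<in> conn en A \<Longrightarrow> (v, u) \<in> conn en A"
    unfolding conn_def by (meson sym_rtrancl symD)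
qed

lemma conn_trans: "(u, v) \<in> conn en A \<Longrightarrow> (v, w) \<in> conn en A \<Longrightarrow> (u, w) \<in> conn en A"
  unfolding conn_def by (rule rtrancl_trans)

lemma conn_edge: "e \<in> A \<Longrightarrow> en e = {u, v} \<Longrightarrow> (u, v) \<in> conn en A"
  unfolding conn_def by (rule r_into_rtrancl) auto

lemma conn_mono: "A \<subseteq> B \<Longrightarrow> conn en A \<subseteq> conn en B"
  unfolding conn_def by (rule rtrancl_mono) auto

lemma conn_empty: "conn en {} = Id"
  by (simp add: conn_def)

lemma conn_induct [consumes 1, case_names refl step]:
  assumes "(u, w) \<in> conn en A" and "P u"
    and "\<And>y z e. (u, y) \<in> conn en A \<Longrightarrow> P y \<Longrightarrow> e \<in> A \<Longrightarrow> en e = {y, z} \<Longrightarrow> P z"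
  shows "P w"
  using assms(1) unfolding conn_def
proof (induction rule: rtrancl_induct)
  case (step y z)
  then show ?case using assms(3) by (auto simp: conn_def)
qed (rule assms(2))

lemma conn_class_eq: "conn en A `` {u} = conn en A `` {v} \<longleftrightarrow> (u, v) \<in> conn en A"
proof
  assume "conn en A `` {u} = conn en A `` {v}"
  then have "v \<in> conn en A `` {u}" by simp
  then show "(u, v) \<in> conn en A" by simp
next
  assume "(u, v) \<in> conn en A"
  then show "conn en A `` {u} = conn en A `` {v}"
    by (auto intro: conn_trans conn_sym)
qed

text \<open>A walk can be shortened until it crosses the new edge at most once, in one of its two
  directions. The new edge adds one pair to the relation for each direction, and
  \<open>rtrancl_insert\<close> handles them one after the other.\<close>

lemma conn_insert:
  assumes "en e = {u, v}"
  shows "(w, z) \<in> conn en (insert e A) \<longleftrightarrow>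
    (w, z) \<in> conn en A \<or> (w, u) \<in> conn en A \<and> (v, z) \<in> conn en A \<or>
    (w, v) \<in> conn en A \<and> (u, z) \<in> conn en A"
proof -
  have "{(a, b). \<exists>f\<in>insert e A. en f = {a, b}} =
      insert (u, v) (insert (v, u) {(a, b). \<exists>f\<in>A. en f = {a, b}})"
    using assms by (auto simp: doubleton_eq_iff)
  then show ?thesis
    unfolding conn_def by (auto simp: rtrancl_insert intro: rtrancl_trans)
qed

section \<open>Counting components while edges are added\<close>

lemma quotient_eq_image: "V // r = (\<lambda>w. r `` {w}) ` V"
  by (auto simp: quotient_def)

text \<open>An edge inside a class changes nothing; any other edge merges exactly the classes of its
  two ends.\<close>

lemma card_components_insert:
  assumes "finite V" "u \<in> V" "v \<in> V" "en e = {u, v}"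
  shows "card (V // conn en A) =
    card (V // conn en (insert e A)) + of_bool ((u, v) \<notin> conn en A)"
proof (cases "(u, v) \<in> conn en A")
  case True
  then have "conn en (insert e A) = conn en A"
    using assms(4) by (auto simp: conn_insert) (meson conn_sym conn_trans)+
  with True show ?thesis by simp
next
  case False
  define C where "C = (\<lambda>w. conn en A `` {w})"
  let ?Q = "V // conn en A"
  have C_eq: "C w = C z \<longleftrightarrow> (w, z) \<in> conn en A" for w z
    by (simp add: C_def conn_class_eq)
  have Q: "?Q = C ` V" by (simp add: quotient_eq_image C_def)
  have fin: "finite ?Q" using assms(1) by (simp add: Q)
  have class': "conn en (insert e A) `` {w} = (if C w \<in> {C u, C v} then C u \<union> C v else C w)" for w
  proof -
    have "conn en (insert e A) `` {w} =
        {x. x \<in> C w \<or> C w = C u \<and> x \<in> C v \<or> C w = C v \<and> x \<in> C u}"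
      by (auto simp: conn_insert[where u = u and v = v and en = en and e = e, OF assms(4)] C_eq)
        (simp_all add: C_def)
    then show ?thesis by auto
  qed
  have Q': "V // conn en (insert e A) = insert (C u \<union> C v) (?Q - {C u, C v})"
    unfolding quotient_eq_image[of V "conn en (insert e A)"] class' Q
    using assms(2,3) by auto
  \<comment> \<open>If the merged class were already among the remaining ones, the count would drop
    by two instead of one.\<close>
  have fresh: "C u \<union> C v \<notin> ?Q - {C u, C v}"
  proof
    assume *: "C u \<union> C v \<in> ?Q - {C u, C v}"
    then obtain w where w: "C u \<union> C v = C w" unfolding Q by blast
    have "u \<in> C u \<union> C v" by (simp add: C_def)
    then have "(w, u) \<in> conn en A" unfolding w by (simp add: C_def)
    then have "C w = C u" by (simp only: C_eq)
    with * w show False by simp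
  qed
  have neq: "C u \<noteq> C v" using False by (simp add: C_eq)
  have sub: "{C u, C v} \<subseteq> ?Q" using assms(2,3) by (auto simp: Q)
  have "card {C u, C v} = 2" using neq by simp
  then have "card (?Q - {C u, C v}) = card ?Q - 2" "card ?Q \<ge> 2"
    using card_Diff_subset[OF _ sub] card_mono[OF fin sub] by simp_all
  moreover have "card (V // conn en (insert e A)) = Suc (card (?Q - {C u, C v}))"
    unfolding Q' using fin fresh by (intro card_insert_disjoint) simp_all
  moreover have "of_bool ((u, v) \<notin> conn en A) = (1 :: nat)" using False by simp
  ultimately show ?thesis by linarith
qed

lemma wf_graph_endsE:
  assumes "wf_graph H" "e \<in> edges H"
  obtains u v where "ends H e = {u, v}" "u \<in> verts H" "v \<in> verts H"
proof -
  have "ends H e \<subseteq> verts H" "card (ends H e) = 1 \<or> card (ends H e) = 2"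
    using assms by (auto simp: wf_graph_def)
  then obtain u v where "ends H e = {u, v}"
    by (metis card_1_singletonE card_2_iff insert_absorb2)
  with \<open>ends H e \<subseteq> verts H\<close> show thesis using that by auto
qed

lemma wf_graph_finite: "wf_graph H \<Longrightarrow> finite (verts H)"
  by (simp add: wf_graph_def)

text \<open>Without edges every vertex is a component, and each edge lowers the number of components
  by at most one. All lower bounds on edge counts below come from this inequality.\<close>

lemma card_verts_le_edges_components:
  assumes "wf_graph H" "A \<subseteq> edges H"
  shows "card (verts H) \<le> card A + card (verts H // conn (ends H) A)"
proof -
  have "finite A" using assms by (auto simp: wf_graph_def intro: finite_subset)
  then show ?thesis using assms(2)
  proof (induction A)
    case empty
    have "verts H // conn (ends H) {} = (\<lambda>w. {w}) ` verts H"
      by (auto simp: quotient_eq_image conn_empty)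
    then show ?case by (simp add: card_image)
  next
    case (insert e A)
    then obtain u v where "ends H e = {u, v}" "u \<in> verts H" "v \<in> verts H"
      using wf_graph_endsE[OF assms(1)] by (metis insert_subset)
    then have "card (verts H // conn (ends H) A) \<le> card (verts H // conn (ends H) (insert e A)) + 1"
      using card_components_insert[of "verts H" u v "ends H" e A] wf_graph_finite[OF assms(1)] by simp
    moreover have "card (verts H) \<le> card A + card (verts H // conn (ends H) A)"
      using insert by simp
    ultimately show ?case using insert.hyps by simp
  qed
qed

section \<open>Acyclicity through bridges and edge counts\<close>

definition bridges_only :: "('e \<Rightarrow> 'v set) \<Rightarrow> 'e set \<Rightarrow> bool" where
  "bridges_only en A \<longleftrightarrow> (\<forall>e\<in>A. \<forall>u v. en e = {u, v} \<longrightarrow> (u, v) \<notin> conn en (A - {e}))"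

lemma bridges_only_subset:
  assumes "bridges_only en A" "B \<subseteq> A"
  shows "bridges_only en B"
proof -
  have "conn en (B - {e}) \<subseteq> conn en (A - {e})" for e
    using assms(2) by (intro conn_mono) auto
  then show ?thesis using assms unfolding bridges_only_def by blast
qed

text \<open>Equality in the general bound persists exactly as long as every added edge merges two
  classes. Conversely, an edge whose removal keeps all classes would leave a smaller set that
  violates the bound.\<close>

lemma bridges_only_iff_card:
  assumes "wf_graph H" "A \<subseteq> edges H"
  shows "bridges_only (ends H) A \<longleftrightarrow>
    card (verts H) = card A + card (verts H // conn (ends H) A)"
proof
  have "finite A" using assms by (auto simp: wf_graph_def intro: finite_subset)
  then show "card (verts H) = card A + card (verts H // conn (ends H) A)"
    if "bridges_only (ends H) A" using assms(2) that
  proof (induction A)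
    case empty
    have "verts H // conn (ends H) {} = (\<lambda>w. {w}) ` verts H"
      by (auto simp: quotient_eq_image conn_empty)
    then show ?case by (simp add: card_image)
  next
    case (insert e A)
    then obtain u v where uv: "ends H e = {u, v}" "u \<in> verts H" "v \<in> verts H"
      using wf_graph_endsE[OF assms(1)] by (metis insert_subset)
    have "bridges_only (ends H) A"
      using insert.prems(2) by (rule bridges_only_subset) auto
    have "(u, v) \<notin> conn (ends H) A"
      using insert.prems(2) insert.hyps(2) uv(1) by (auto simp: bridges_only_def)
    then have "card (verts H // conn (ends H) A) = card (verts H // conn (ends H) (insert e A)) + 1"
      using uv card_components_insert[of "verts H" u v "ends H" e A] wf_graph_finite[OF assms(1)]
      by simp
    moreover have "card (verts H) = card A + card (verts H // conn (ends H) A)"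
      using insert.IH insert.prems(1) \<open>bridges_only (ends H) A\<close> by simp
    ultimately show ?case using insert.hyps by simp
  qed
next
  assume eq: "card (verts H) = card A + card (verts H // conn (ends H) A)"
  have "finite A" using assms by (auto simp: wf_graph_def intro: finite_subset)
  show "bridges_only (ends H) A"
    unfolding bridges_only_def
  proof (intro ballI allI impI notI)
    fix e u v assume e: "e \<in> A" "ends H e = {u, v}" "(u, v) \<in> conn (ends H) (A - {e})"
    then have "u \<in> verts H" "v \<in> verts H" using assms by (fastforce simp: wf_graph_def)+
    with e card_components_insert[of "verts H" u v "ends H" e "A - {e}"] wf_graph_finite[OF assms(1)]
    have "card (verts H // conn (ends H) (A - {e})) = card (verts H // conn (ends H) A)"
      by (simp add: insert_absorb)
    moreover have "card (verts H) \<le> card (A - {e}) + card (verts H // conn (ends H) (A - {e}))"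
      using assms by (intro card_verts_le_edges_components) auto
    moreover have "card (A - {e}) < card A" using \<open>finite A\<close> e(1) by (rule card_Diff1_less)
    ultimately show False using eq by simp
  qed
qed

lemma conn_imp_path:
  assumes "(u, v) \<in> conn en A"
  shows "\<exists>vs es. length vs = Suc (length es) \<and> distinct vs \<and> hd vs = u \<and> last vs = v \<and>
    set es \<subseteq> A \<and> (\<forall>i<length es. en (es ! i) = {vs ! i, vs ! Suc i})"
  using assms unfolding conn_def
proof (induction rule: converse_rtrancl_induct)
  case base
  show ?case by (rule exI[of _ "[v]"], rule exI[of _ "[]"]) auto
next
  case (step u u')
  then obtain e vs es where e: "e \<in> A" "en e = {u, u'}"
    and p: "length vs = Suc (length es)" "distinct vs" "hd vs = u'" "last vs = v"
      "set es \<subseteq> A" "\<forall>i<length es. en (es ! i) = {vs ! i, vs ! Suc i}" by auto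
  have vs: "vs \<noteq> []" using p(1) by auto
  show ?case
  proof (cases "u \<in> set vs")
    case True
    then obtain j where j: "j < length vs" "vs ! j = u" by (auto simp: in_set_conv_nth)
    have "set (drop j es) \<subseteq> A"
      using p(5) set_drop_subset[of j es] by blast
    moreover have "\<forall>i<length (drop j es). en (drop j es ! i) = {drop j vs ! i, drop j vs ! Suc i}"
      using p(1,6) by simp
    ultimately have "length (drop j vs) = Suc (length (drop j es)) \<and> distinct (drop j vs) \<and>
        hd (drop j vs) = u \<and> last (drop j vs) = v \<and> set (drop j es) \<subseteq> A \<and>
        (\<forall>i<length (drop j es). en (drop j es ! i) = {drop j vs ! i, drop j vs ! Suc i})"
      using j p(1,2,4) by (simp add: hd_drop_conv_nth)
    then show ?thesis by blast
  next
    case False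
    have "en ((e # es) ! i) = {(u # vs) ! i, (u # vs) ! Suc i}" if "i < length (e # es)" for i
      using that e(2) p(3,6) vs by (cases i) (simp_all add: hd_conv_nth)
    then have "length (u # vs) = Suc (length (e # es)) \<and> distinct (u # vs) \<and>
        hd (u # vs) = u \<and> last (u # vs) = v \<and> set (e # es) \<subseteq> A \<and>
        (\<forall>i<length (e # es). en ((e # es) ! i) = {(u # vs) ! i, (u # vs) ! Suc i})"
      using False e(1) p(1,2,4,5) vs by simp
    then show ?thesis by blast
  qed
qed

text \<open>An edge whose ends stay connected without it closes a path to a cycle, and the last edge
  of a cycle is bypassed by the other ones. Loops fit in: since \<open>conn\<close> is reflexive, a
  loop is never a bridge.\<close>

lemma acyclic_iff_bridges_only:
  assumes "wf_graph H"
  shows "(\<nexists>vs es. is_cycle H vs es) \<longleftrightarrow> bridges_only (ends H) (edges H)"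
proof
  assume acyc: "\<nexists>vs es. is_cycle H vs es"
  show "bridges_only (ends H) (edges H)"
    unfolding bridges_only_def
  proof (intro ballI allI impI notI)
    fix e u v assume e: "e \<in> edges H" "ends H e = {u, v}"
      and uv: "(u, v) \<in> conn (ends H) (edges H - {e})"
    from conn_imp_path[OF uv] obtain vs es where p:
      "length vs = Suc (length es)" "distinct vs" "hd vs = u" "last vs = v"
      "set es \<subseteq> edges H - {e}" "\<forall>i<length es. ends H (es ! i) = {vs ! i, vs ! Suc i}"
      by (elim exE conjE)
    have vs: "vs \<noteq> []" using p(1) by auto
    \<comment> \<open>A repeated edge would put the vertex at position \<open>i\<close> also at
      position \<open>j\<close> or \<open>Suc j\<close>, although the vertices of the path are
      distinct.\<close>
    have neq: "es ! i \<noteq> es ! j" if "i < j" "j < length es" for i j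
    proof
      assume "es ! i = es ! j"
      then have "{vs ! i, vs ! Suc i} = {vs ! j, vs ! Suc j}" using p(6) that
        by (metis less_trans)
      then have "vs ! i = vs ! j \<or> vs ! i = vs ! Suc j" by auto
      then show False using that p(1,2) by (auto simp: nth_eq_iff_index_eq)
    qed
    have "distinct es"
      unfolding distinct_conv_nth
    proof (intro allI impI)
      fix i j assume "i < length es" "j < length es" "i \<noteq> j"
      then show "es ! i \<noteq> es ! j" using neq[of i j] neq[of j i] by (cases i j rule: linorder_cases) auto
    qed
    \<comment> \<open>The edge \<open>e\<close> takes the last place, where the successor index
      wraps round to \<open>0\<close>. If \<open>e\<close> is a loop, the path is a single vertex
      and the cycle has length 1.\<close>
    have en: "ends H ((es @ [e]) ! i) = {vs ! i, vs ! (Suc i mod length vs)}"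
      if "i < length vs" for i
    proof (cases "i < length es")
      case True
      then show ?thesis using p(1,6) by (simp add: nth_append)
    next
      case False
      then have "i = length es" using that p(1) by simp
      then show ?thesis using e(2) p(1,3,4) vs
        by (auto simp: nth_append hd_conv_nth last_conv_nth)
    qed
    have es: "set (es @ [e]) \<subseteq> edges H" using e(1) p(5) by auto
    have "set vs \<subseteq> verts H"
    proof
      fix w assume "w \<in> set vs"
      then obtain i where i: "i < length vs" "w = vs ! i" by (auto simp: in_set_conv_nth)
      then have "w \<in> ends H ((es @ [e]) ! i)" using en by simp
      moreover have "(es @ [e]) ! i \<in> edges H"
        using es i p(1) nth_mem[of i "es @ [e]"] by auto
      ultimately show "w \<in> verts H" using assms by (auto simp: wf_graph_def)
    qed
    then have "is_cycle H vs (es @ [e])"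
      unfolding is_cycle_def using vs p(1,2,5) es en \<open>distinct es\<close> by auto
    with acyc show False by blast
  qed
next
  assume br: "bridges_only (ends H) (edges H)"
  show "\<nexists>vs es. is_cycle H vs es"
  proof (intro notI, elim exE)
    fix vs es assume c: "is_cycle H vs es"
    define m where "m = length vs - 1"
    have len: "length vs = Suc m" "length es = Suc m"
      using c by (auto simp: is_cycle_def m_def)
    have en: "ends H (es ! i) = {vs ! i, vs ! (Suc i mod Suc m)}" if "i \<le> m" for i
      using c that by (auto simp: is_cycle_def len)
    have es: "es ! i \<in> edges H" if "i \<le> m" for i
      using c that len nth_mem[of i es] by (auto simp: is_cycle_def)
    have "(vs ! 0, vs ! i) \<in> conn (ends H) (edges H - {es ! m})" if "i \<le> m" for i
      using that
    proof (induction i)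
      case (Suc i)
      then have "es ! i \<noteq> es ! m" using c len by (auto simp: is_cycle_def nth_eq_iff_index_eq)
      then have "(vs ! i, vs ! Suc i) \<in> conn (ends H) (edges H - {es ! m})"
        using Suc.prems es[of i] en[of i] by (intro conn_edge[of "es ! i"]) auto
      with Suc show ?case by (auto intro: conn_trans)
    qed simp
    then have "(vs ! m, vs ! 0) \<in> conn (ends H) (edges H - {es ! m})"
      by (blast intro: conn_sym)
    moreover have "ends H (es ! m) = {vs ! m, vs ! 0}" using en[of m] by simp
    ultimately show False using br es[of m] by (auto simp: bridges_only_def)
  qed
qed

lemma connected_graph_iff_num_components:
  assumes "wf_graph H" "verts H \<noteq> {}"
  shows "connected_graph H \<longleftrightarrow> num_components H \<le> 1"
proof -
  have "finite (graph_components H)"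
    using assms by (simp add: graph_components_def quotient_eq_image wf_graph_def)
  then have "num_components H \<le> 1 \<longleftrightarrow>
      (\<forall>C\<in>graph_components H. \<forall>D\<in>graph_components H. C = D)"
    by (auto simp: num_components_def card_le_Suc0_iff_eq)
  also have "\<dots> \<longleftrightarrow> connected_graph H"
    using assms(2) unfolding graph_components_def quotient_eq_image connected_graph_def
      adjacency_rtrancl by (auto simp: conn_class_eq)
  finally show ?thesis ..
qed

lemma num_components_pos:
  assumes "wf_graph H" "verts H \<noteq> {}"
  shows "num_components H \<ge> 1"
proof -
  have "finite (graph_components H)" "graph_components H \<noteq> {}"
    using assms by (simp_all add: graph_components_def quotient_eq_image wf_graph_def)
  then have "num_components H > 0" by (simp add: num_components_def card_gt_0_iff)
  then show ?thesis by simp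
qed

lemma card_verts_le_nullity:
  assumes "wf_graph H"
  shows "card (verts H) \<le> card (edges H) + num_components H"
  using card_verts_le_edges_components[OF assms order_refl]
  by (simp add: num_components_def graph_components_def adjacency_rtrancl)

text \<open>Trades the absence of cycles for an edge count, the form that adds up under
  gluing.\<close>

lemma is_tree_iff:
  assumes "wf_graph H"
  shows "is_tree H \<longleftrightarrow> connected_graph H \<and> card (edges H) + 1 = card (verts H)"
proof (cases "connected_graph H")
  case True
  then have "verts H \<noteq> {}" by (simp add: connected_graph_def)
  with True assms have "num_components H = 1"
    using connected_graph_iff_num_components[of H] num_components_pos[of H] by simp
  then have "card (verts H // conn (ends H) (edges H)) = 1"
    by (simp add: num_components_def graph_components_def adjacency_rtrancl)
  then show ?thesis
    unfolding is_tree_def acyclic_iff_bridges_only[OF assms]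
      bridges_only_iff_card[OF assms order_refl] using True by simp linarith
qed (simp add: is_tree_def)

section \<open>The Tutte polynomial at (1,1)\<close>

lemma wf_graph_spanning_subgraph:
  assumes "wf_graph G" "A \<subseteq> edges G"
  shows "wf_graph (G\<lparr>edges := A\<rparr>)"
  using assms by (auto simp: wf_graph_def intro: finite_subset)

lemma inj_spanning_subgraph: "inj (\<lambda>A. G\<lparr>edges := A\<rparr>)"
  by (rule injI) (metis select_convs(2) surjective update_convs(2))

text \<open>Both bases are 0 and \<open>0 ^ 0 = 1\<close>, so a term is 1 if both exponents vanish
  and 0 otherwise. Vanishing rank difference means connected, and vanishing nullity then fixes the
  edge count of a tree.\<close>

lemma tutte_1_1:
  fixes G :: "('v, 'e) graph"
  assumes wf: "wf_graph G" and con: "connected_graph G"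
  shows "tutte G (1 :: 'a::comm_ring_1) 1 = of_nat (num_spanning_trees G)"
proof -
  have ne: "verts G \<noteq> {}" using con by (simp add: connected_graph_def)
  have fin: "finite (spanning_subgraphs G)"
    using wf by (simp add: spanning_subgraphs_def wf_graph_def)
  have tree: "graph_rank G - graph_rank H = 0 \<and> nullity H = 0 \<longleftrightarrow> is_tree H"
    if "H \<in> spanning_subgraphs G" for H
  proof -
    have H: "wf_graph H" "verts H = verts G"
      using that wf_graph_spanning_subgraph[OF wf] by (auto simp: spanning_subgraphs_def)
    have "num_components G = 1"
      using con wf ne connected_graph_iff_num_components[of G] num_components_pos[of G] by simp
    moreover have "num_components H \<ge> 1" "connected_graph H \<longleftrightarrow> num_components H \<le> 1"
      using H ne num_components_pos[of H] connected_graph_iff_num_components[of H] by simp_all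
    moreover have "card (verts G) > 0" using wf ne by (auto simp: wf_graph_def card_gt_0_iff)
    \<comment> \<open>The truncated rank difference is 0 as soon as the rank of \<open>G\<close>
      does not exceed that of \<open>H\<close>. This bound keeps the rank of \<open>H\<close> itself
      from being truncated, which matters for a single vertex.\<close>
    moreover have "num_components H \<le> card (verts G)"
      unfolding num_components_def graph_components_def quotient_eq_image H(2)
      using wf by (intro card_image_le) (simp add: wf_graph_def)
    moreover have "card (verts G) \<le> card (edges H) + num_components H"
      using card_verts_le_nullity[OF H(1)] H(2) by simp
    ultimately show ?thesis
      unfolding is_tree_iff[OF H(1)] graph_rank_def nullity_def H(2) by auto
  qed
  have "tutte G (1 :: 'a) 1 = (\<Sum>H\<in>spanning_subgraphs G. of_bool (is_tree H))"
    unfolding tutte_def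
  proof (rule sum.cong)
    fix H assume "H \<in> spanning_subgraphs G"
    from tree[OF this] show "(1 - 1 :: 'a) ^ (graph_rank G - graph_rank H) * (1 - 1) ^ nullity H
        = of_bool (is_tree H)"
      by (cases "graph_rank G - graph_rank H = 0"; cases "nullity H = 0") (auto simp: power_0_left)
  qed simp
  also have "\<dots> = of_nat (num_spanning_trees G)"
    using fin by (simp add: num_spanning_trees_def sum_of_bool_eq Int_def)
  finally show ?thesis .
qed

text \<open>There are at most two classes, those of \<open>X\<close> and \<open>Y\<close>, and only
  one if these coincide. Spanning trees and separating forests are the sets that attain the
  bound.\<close>

lemma spanned_card_bound:
  assumes "wf_graph H" "A \<subseteq> edges H"
    and "\<forall>z\<in>verts H. (z, X) \<in> conn (ends H) A \<or> (z, Y) \<in> conn (ends H) A"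
  shows "card (verts H) + of_bool ((X, Y) \<in> conn (ends H) A) \<le> card A + 2"
proof -
  let ?C = "\<lambda>w. conn (ends H) A `` {w}"
  have "verts H // conn (ends H) A \<subseteq> {?C X, ?C Y}"
    unfolding quotient_eq_image image_subset_iff insert_iff conn_class_eq using assms(3) by simp
  then have "card (verts H // conn (ends H) A) \<le> card {?C X, ?C Y}"
    by (intro card_mono) simp_all
  also have "\<dots> = 2 - of_bool ((X, Y) \<in> conn (ends H) A)"
    by (simp add: card_insert_if conn_class_eq)
  finally show ?thesis
    using card_verts_le_edges_components[OF assms(1,2)] by (cases "(X, Y) \<in> conn (ends H) A") simp_all
qed

section \<open>Gluing four copies\<close>

lemma sum_copy: "(\<Sum>i\<in>UNIV. f i) = f C1 + f C2 + f C3 + f C4"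
  for f :: "copy \<Rightarrow> 'a::comm_monoid_add"
  by (simp add: UNIV_copy add.assoc)

instance copy :: finite
  by standard (simp add: UNIV_copy)

lemma glue_inj: "X \<noteq> Y \<Longrightarrow> glue X Y i u = glue X Y i v \<Longrightarrow> u = v"
  by (auto simp: glue_def split: if_splits)

text \<open>The reason why walks can be analysed copy by copy: apart from the new edge, a walk
  changes copies only at special vertices.\<close>

lemma glue_eq_special:
  "glue X Y i u = glue X Y j v \<Longrightarrow> i \<noteq> j \<Longrightarrow> u \<in> {X, Y} \<and> v \<in> {X, Y}"
  by (cases i; cases j) (auto simp: glue_def split: if_splits)

text \<open>The incidence map of the construction, freed from \<open>Gn\<close>. As there, the
  catch-all case also gives \<open>E0\<close> the ends of the new edge, hence the assumption
  \<open>E0 \<notin> A\<close> in the lemmas on walks.\<close>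

definition glue_ends :: "vertex \<Rightarrow> vertex \<Rightarrow> (edge \<Rightarrow> vertex set) \<Rightarrow> edge \<Rightarrow> vertex set" where
  "glue_ends X Y en e = (case e of ECopy i e' \<Rightarrow> glue X Y i ` en e'
     | _ \<Rightarrow> {glue X Y C1 Y, glue X Y C2 Y})"

text \<open>
  The pattern of the construction is the graph with edge \<open>None\<close> for the new edge and an edge
  \<open>Some i\<close> for the \<open>i\<close>-th copy. An edge set of the glued graph is contracted to those pattern
  edges whose two ends it connects inside the corresponding part.
\<close>

definition pattern_ends :: "vertex \<Rightarrow> vertex \<Rightarrow> copy option \<Rightarrow> vertex set" where
  "pattern_ends X Y k = (case k of None \<Rightarrow> {glue X Y C1 Y, glue X Y C2 Y}
     | Some i \<Rightarrow> {glue X Y i X, glue X Y i Y})"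

definition contract ::
  "vertex \<Rightarrow> vertex \<Rightarrow> (edge \<Rightarrow> vertex set) \<Rightarrow> edge set \<Rightarrow> copy option set" where
  "contract X Y en A = {k. case k of None \<Rightarrow> ENew \<in> A
     | Some i \<Rightarrow> (X, Y) \<in> conn en (ECopy i -` A)}"

lemma conn_glue:
  assumes "(u, v) \<in> conn en (ECopy i -` A)"
  shows "(glue X Y i u, glue X Y i v) \<in> conn (glue_ends X Y en) A"
  using assms
proof (induction rule: conn_induct)
  case (step y z e)
  then have "(glue X Y i y, glue X Y i z) \<in> conn (glue_ends X Y en) A"
    by (intro conn_edge[of "ECopy i e"]) (auto simp: glue_ends_def)
  with step.IH show ?case by (rule conn_trans)
qed simp

lemma glue_ends_ECopyE:
  assumes "X \<noteq> Y" "glue_ends X Y en (ECopy i e) = {y, z}"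
  obtains u v where "en e = {u, v}" "y = glue X Y i u" "z = glue X Y i v"
proof -
  have im: "glue X Y i ` en e = {y, z}" using assms(2) by (simp add: glue_ends_def)
  then obtain u v where uv: "u \<in> en e" "v \<in> en e" "y = glue X Y i u" "z = glue X Y i v"
    by (metis imageE insertI1 insertI2)
  have "en e \<subseteq> {u, v}"
  proof
    fix w assume "w \<in> en e"
    then have "glue X Y i w = y \<or> glue X Y i w = z" using im by blast
    then show "w \<in> {u, v}" using uv(3,4) glue_inj[OF assms(1)] by blast
  qed
  with uv that show thesis by blast
qed

text \<open>A walk between special vertices is cut at the special vertices that it visits. Each
  piece is the new edge or stays inside one copy, and a piece joining the two special vertices of a
  copy witnesses the pattern edge of that copy.\<close>

lemma conn_contract_special:
  assumes XY: "X \<noteq> Y" and E0: "E0 \<notin> A"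
    and t: "z \<in> {X, Y}" "(s, glue X Y i z) \<in> conn (glue_ends X Y en) A"
    and s: "s = glue X Y j q" "q \<in> {X, Y}"
  shows "(s, glue X Y i z) \<in> conn (pattern_ends X Y) (contract X Y en A)"
proof -
  let ?g = "glue X Y" and ?K = "conn (pattern_ends X Y) (contract X Y en A)"
  \<comment> \<open>The invariant along the walk: \<open>p\<close> is a special vertex through which
    the walk has entered copy \<open>i\<close>, already reached in the pattern, and the rest of the
    way to \<open>z\<close> lies inside that copy.\<close>
  define P where "P = (\<lambda>w. \<exists>i z p. w = ?g i z \<and> p \<in> {X, Y} \<and> (s, ?g i p) \<in> ?K \<and>
    (p, z) \<in> conn en (ECopy i -` A))"
  have special: "(s, ?g i z) \<in> ?K" if Pz: "P (?g i z)" and z: "z \<in> {X, Y}" for i z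
  proof -
    obtain i' z' p where *: "?g i z = ?g i' z'" "p \<in> {X, Y}" "(s, ?g i' p) \<in> ?K"
      "(p, z') \<in> conn en (ECopy i' -` A)" using Pz unfolding P_def by blast
    \<comment> \<open>A glued special vertex has two names, so the copy in the invariant need not be
      \<open>i\<close>. Under either name it is special.\<close>
    have "z' \<in> {X, Y}"
    proof (cases "i = i'")
      case True
      then have "z = z'" using glue_inj[OF XY, of i z z'] *(1) by simp
      with z show ?thesis by simp
    next
      case False
      from glue_eq_special[OF *(1) False] show ?thesis by simp
    qed
    have "(?g i' p, ?g i' z') \<in> ?K"
    proof (cases "p = z'")
      case False
      then have "(X, Y) \<in> conn en (ECopy i' -` A)" and pz: "{p, z'} = {X, Y}"
        using *(2,4) \<open>z' \<in> {X, Y}\<close> by (auto intro: conn_sym)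
      then have "Some i' \<in> contract X Y en A" by (simp add: contract_def)
      moreover have "pattern_ends X Y (Some i') = {?g i' p, ?g i' z'}"
        using pz by (auto simp: pattern_ends_def doubleton_eq_iff)
      ultimately show ?thesis by (rule conn_edge)
    qed simp
    with *(1,3) show ?thesis by (auto intro: conn_trans)
  qed
  have base: "P (?g i z)" if "(s, ?g i z) \<in> ?K" "z \<in> {X, Y}" for i z
    unfolding P_def using that by (intro exI[of _ i] exI[of _ z]) simp
  have "P (?g i z)" using t(2)
  proof (induction rule: conn_induct)
    case refl
    have "P (?g j q)" using s by (intro base) simp_all
    then show ?case using s(1) by simp
  next
    case (step y w e)
    show ?case
    proof (cases e)
      case E0
      with assms(2) step.hyps show ?thesis by simp
    next
      case (ECopy k f)
      obtain u v where uv: "en f = {u, v}" "y = ?g k u" "w = ?g k v"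
        using glue_ends_ECopyE[OF XY] step.hyps(3) unfolding ECopy by metis
      have step_uv: "(u, v) \<in> conn en (ECopy k -` A)"
        using step.hyps(2) uv(1) ECopy by (intro conn_edge[of f]) auto
      obtain i' z' p where *: "y = ?g i' z'" "p \<in> {X, Y}" "(s, ?g i' p) \<in> ?K"
        "(p, z') \<in> conn en (ECopy i' -` A)" using step.IH unfolding P_def by blast
      show ?thesis
      proof (cases "i' = k")
        case True
        then have "z' = u" using glue_inj[OF XY, of k z' u] *(1) uv(2) by simp
        then have "(p, v) \<in> conn en (ECopy k -` A)"
          using *(4) step_uv True by (auto intro: conn_trans)
        then show ?thesis unfolding P_def using *(2,3) True uv(3) by blast
      next
        case False
        then have "u \<in> {X, Y}" using glue_eq_special[of X Y i' z' k u] *(1) uv(2) by simp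
        moreover from this have "(s, ?g k u) \<in> ?K"
          using special[of k u] step.IH uv(2) by simp
        ultimately show ?thesis unfolding P_def using step_uv uv(3) by blast
      qed
    next
      case ENew
      then have "None \<in> contract X Y en A" using step.hyps(2) by (simp add: contract_def)
      moreover have yw: "{y, w} = {?g C1 Y, ?g C2 Y}"
        using step.hyps(3) ENew by (simp add: glue_ends_def)
      ultimately have "(y, w) \<in> ?K"
        by (intro conn_edge[of None]) (simp_all add: pattern_ends_def)
      moreover obtain k k' where k: "y = ?g k Y" "w = ?g k' Y"
        using yw by (auto simp: doubleton_eq_iff)
      moreover have "(s, y) \<in> ?K" using special[of k Y] step.IH k(1) by simp
      ultimately show ?thesis using base[of k' Y] by (auto intro: conn_trans)
    qed
  qed
  then show ?thesis using t(1) by (rule special)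
qed

lemma conn_glue_of_pattern:
  assumes "(s, t) \<in> conn (pattern_ends X Y) (contract X Y en A)"
  shows "(s, t) \<in> conn (glue_ends X Y en) A"
  using assms
proof (induction rule: conn_induct)
  case (step y z k)
  have "(y, z) \<in> conn (glue_ends X Y en) A"
  proof (cases k)
    case None
    then show ?thesis using step.hyps
      by (intro conn_edge[of ENew]) (simp_all add: contract_def pattern_ends_def glue_ends_def)
  next
    case (Some i)
    then have "(glue X Y i X, glue X Y i Y) \<in> conn (glue_ends X Y en) A"
      using step.hyps by (intro conn_glue) (simp add: contract_def)
    then show ?thesis
      using step.hyps Some by (auto simp: pattern_ends_def doubleton_eq_iff intro: conn_sym)
  qed
  with step.IH show ?case by (rule conn_trans)
qed simp

lemma conn_glue_iff_pattern:
  assumes "X \<noteq> Y" "E0 \<notin> A" "p \<in> {X, Y}" "q \<in> {X, Y}"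
  shows "(glue X Y i p, glue X Y j q) \<in> conn (glue_ends X Y en) A \<longleftrightarrow>
    (glue X Y i p, glue X Y j q) \<in> conn (pattern_ends X Y) (contract X Y en A)"
  using conn_contract_special[OF assms(1,2,4) _ refl assms(3)] conn_glue_of_pattern by blast

text \<open>Until it first meets a special vertex, the walk cannot leave copy \<open>i\<close>. The
  invariant says that the walk is still inside the copy or that the conclusion has been reached; the
  second alternative absorbs whatever the walk does afterwards.\<close>

lemma conn_special_of_glue:
  assumes XY: "X \<noteq> Y" and E0: "E0 \<notin> A"
    and "(glue X Y i z, glue X Y j q) \<in> conn (glue_ends X Y en) A" "q \<in> {X, Y}"
  shows "(z, X) \<in> conn en (ECopy i -` A) \<or> (z, Y) \<in> conn en (ECopy i -` A)" (is ?concl)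
proof -
  let ?g = "glue X Y"
  define P where "P = (\<lambda>w. (\<exists>z'. w = ?g i z' \<and> (z, z') \<in> conn en (ECopy i -` A)) \<or> ?concl)"
  have P_dest: "\<exists>z'. w = ?g i z' \<and> (z, z') \<in> conn en (ECopy i -` A)"
    if Pw: "P w" and n: "\<not> ?concl" for w
    using Pw unfolding P_def
  proof (rule disjE)
    assume ?concl
    with n show ?thesis by contradiction
  qed assumption
  have special: ?concl if Pu: "P (?g k u)" and u: "u \<in> {X, Y}" for k u
  proof (rule ccontr)
    assume n: "\<not> ?concl"
    then obtain z' where z': "?g k u = ?g i z'" "(z, z') \<in> conn en (ECopy i -` A)"
      using P_dest[OF Pu n] by blast
    have "z' \<in> {X, Y}"
    proof (cases "k = i")
      case True
      then show ?thesis using glue_inj[OF XY, of i u z'] z'(1) u by simp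
    next
      case False
      from glue_eq_special[OF z'(1) False] show ?thesis by simp
    qed
    with z'(2) n show False by auto
  qed
  have "P (?g j q)" using assms(3)
  proof (induction rule: conn_induct)
    case refl
    show ?case unfolding P_def by (intro disjI1 exI[of _ z]) simp
  next
    case (step y w e)
    show ?case
    proof (cases e)
      case E0
      with assms(2) step.hyps show ?thesis by simp
    next
      case (ECopy k f)
      obtain u v where uv: "en f = {u, v}" "y = ?g k u" "w = ?g k v"
        using glue_ends_ECopyE[OF XY] step.hyps(3) unfolding ECopy by metis
      show ?thesis
      proof (cases "k = i")
        case True
        have uv': "(u, v) \<in> conn en (ECopy i -` A)"
          using step.hyps(2) uv(1) ECopy True by (intro conn_edge[of f]) auto
        show ?thesis
        proof (cases ?concl)
          case c: False
          then obtain z' where z': "y = ?g i z'" "(z, z') \<in> conn en (ECopy i -` A)"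
            using P_dest[OF step.IH c] by blast
          have "?g i z' = ?g i u" using z'(1) uv(2) unfolding True by (rule subst)
          then have "z' = u" by (rule glue_inj[OF XY])
          then have "(z, v) \<in> conn en (ECopy i -` A)" using conn_trans[OF z'(2)] uv' by blast
          then show ?thesis unfolding P_def using uv(3) True by blast
        qed (simp add: P_def)
      next
        case False
        have ?concl
        proof (rule ccontr)
          assume n: "\<not> ?concl"
          obtain z' where "y = ?g i z'" using P_dest[OF step.IH n] by blast
          then have "u \<in> {X, Y}" using glue_eq_special[of X Y k u i z'] uv(2) False by simp
          then show False using special[of k u] step.IH uv(2) n by simp
        qed
        then show ?thesis unfolding P_def by blast
      qed
    next
      case ENew
      then obtain k where "y = ?g k Y"
        using step.hyps(3) by (auto simp: glue_ends_def doubleton_eq_iff)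
      then have ?concl using special[of k Y] step.IH by simp
      then show ?thesis unfolding P_def by blast
    qed
  qed
  then show ?thesis using assms(4) by (rule special)
qed

text \<open>The common part of the two kinds of edge set, which differ only in whether
  \<open>X\<close> and \<open>Y\<close> are connected and in the resulting edge count.\<close>

definition spanned :: "vertex \<Rightarrow> vertex \<Rightarrow> vertex set \<Rightarrow> ('e \<Rightarrow> vertex set) \<Rightarrow> 'e set \<Rightarrow> bool" where
  "spanned X Y V en A \<longleftrightarrow> (\<forall>z\<in>V. (z, X) \<in> conn en A \<or> (z, Y) \<in> conn en A)"

definition pattern_verts :: "vertex \<Rightarrow> vertex \<Rightarrow> vertex set" where
  "pattern_verts X Y = {glue X Y C1 X, glue X Y C3 Y, glue X Y C1 Y, glue X Y C2 Y}"

lemma pattern_verts_eq: "X \<noteq> Y \<Longrightarrow> pattern_verts X Y = (\<Union>i. glue X Y i ` {X, Y})"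
  unfolding pattern_verts_def UNIV_copy by (auto simp: glue_def)

lemma card_pattern_verts: "X \<noteq> Y \<Longrightarrow> card (pattern_verts X Y) = 4"
  by (simp add: pattern_verts_def glue_def)

text \<open>On its way to an outer special vertex, a vertex must first reach a special vertex of its
  own copy; from there on only the pattern matters.\<close>

lemma spanned_glue_iff:
  assumes XY: "X \<noteq> Y" "E0 \<notin> A" and V: "X \<in> V" "Y \<in> V"
  shows "spanned (glue X Y C1 X) (glue X Y C3 Y) (\<Union>i. glue X Y i ` V) (glue_ends X Y en) A \<longleftrightarrow>
    (\<forall>i. spanned X Y V en (ECopy i -` A)) \<and>
    spanned (glue X Y C1 X) (glue X Y C3 Y) (pattern_verts X Y) (pattern_ends X Y)
      (contract X Y en A)"
    (is "?L \<longleftrightarrow> ?R1 \<and> ?R2")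
proof (intro iffI conjI)
  assume L: ?L
  show ?R1
    unfolding spanned_def
  proof (intro allI ballI)
    fix i z assume "z \<in> V"
    with L have "(glue X Y i z, glue X Y C1 X) \<in> conn (glue_ends X Y en) A \<or>
        (glue X Y i z, glue X Y C3 Y) \<in> conn (glue_ends X Y en) A"
      unfolding spanned_def by blast
    then show "(z, X) \<in> conn en (ECopy i -` A) \<or> (z, Y) \<in> conn en (ECopy i -` A)"
      using conn_special_of_glue[OF XY] by blast
  qed
  show ?R2
    unfolding spanned_def pattern_verts_eq[OF XY(1)]
  proof
    fix t assume "t \<in> (\<Union>i. glue X Y i ` {X, Y})"
    then obtain i p where t: "t = glue X Y i p" "p \<in> {X, Y}" by blast
    then have "p \<in> V" using V by blast
    with L t(1) have "(glue X Y i p, glue X Y C1 X) \<in> conn (glue_ends X Y en) A \<or>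
        (glue X Y i p, glue X Y C3 Y) \<in> conn (glue_ends X Y en) A"
      unfolding spanned_def by blast
    then show "(t, glue X Y C1 X) \<in> conn (pattern_ends X Y) (contract X Y en A) \<or>
        (t, glue X Y C3 Y) \<in> conn (pattern_ends X Y) (contract X Y en A)"
      using conn_glue_iff_pattern[OF XY t(2)] t(1) by simp
  qed
next
  assume R: "?R1 \<and> ?R2"
  show ?L
    unfolding spanned_def
  proof
    fix w assume "w \<in> (\<Union>i. glue X Y i ` V)"
    then obtain i z where w: "w = glue X Y i z" "z \<in> V" by blast
    then obtain p where p: "p \<in> {X, Y}" "(z, p) \<in> conn en (ECopy i -` A)"
      using R unfolding spanned_def by blast
    from p(2) have wp: "(w, glue X Y i p) \<in> conn (glue_ends X Y en) A"
      unfolding w(1) by (rule conn_glue)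
    have "glue X Y i p \<in> pattern_verts X Y" using p(1) unfolding pattern_verts_eq[OF XY(1)] by blast
    then have "(glue X Y i p, glue X Y C1 X) \<in> conn (glue_ends X Y en) A \<or>
        (glue X Y i p, glue X Y C3 Y) \<in> conn (glue_ends X Y en) A"
      using R conn_glue_of_pattern unfolding spanned_def by blast
    then show "(w, glue X Y C1 X) \<in> conn (glue_ends X Y en) A \<or>
        (w, glue X Y C3 Y) \<in> conn (glue_ends X Y en) A"
      using conn_trans[OF wp] by blast
  qed
qed

section \<open>Enumeration on the pattern graph\<close>

lemma wf_pattern:
  assumes "X \<noteq> Y"
  shows "wf_graph \<lparr>verts = pattern_verts X Y, edges = UNIV, ends = pattern_ends X Y\<rparr>"
proof -
  have "pattern_ends X Y k \<subseteq> pattern_verts X Y \<and> card (pattern_ends X Y k) = 2" for k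
    using assms by (cases k; cases "the k") (auto simp: pattern_ends_def pattern_verts_def glue_def)
  then show ?thesis by (simp add: wf_graph_def pattern_verts_def)
qed

lemma pattern_card_bound:
  assumes "X \<noteq> Y"
    and "spanned (glue X Y C1 X) (glue X Y C3 Y) (pattern_verts X Y) (pattern_ends X Y) B"
  shows "2 + of_bool ((glue X Y C1 X, glue X Y C3 Y) \<in> conn (pattern_ends X Y) B) \<le> card B"
  using spanned_card_bound[OF wf_pattern[OF assms(1)], of B] assms
  by (simp add: spanned_def card_pattern_verts)

text \<open>The right-hand sides list the simple paths starting in \<open>x\<close> and in
  \<open>y\<close>. They are closed under every pattern edge, which gives one direction; for the
  other, each path is a chain of equations between classes that rewriting can follow.\<close>

lemma pattern_conn_iff:
  assumes XY: "X \<noteq> Y"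
  defines "x \<equiv> glue X Y C1 X" and "y \<equiv> glue X Y C3 Y" and "a \<equiv> glue X Y C1 Y" and "b \<equiv> glue X Y C2 Y"
  shows "(x, w) \<in> conn (pattern_ends X Y) B \<longleftrightarrow>
     w = x \<or>
     w = a \<and> (Some C1 \<in> B \<or> Some C2 \<in> B \<and> (None \<in> B \<or> Some C4 \<in> B \<and> Some C3 \<in> B)) \<or>
     w = b \<and> (Some C2 \<in> B \<or> Some C1 \<in> B \<and> (None \<in> B \<or> Some C4 \<in> B \<and> Some C3 \<in> B)) \<or>
     w = y \<and> (Some C1 \<in> B \<and> Some C3 \<in> B \<or> Some C2 \<in> B \<and> Some C4 \<in> B \<or>
       None \<in> B \<and> (Some C1 \<in> B \<and> Some C4 \<in> B \<or> Some C2 \<in> B \<and> Some C3 \<in> B))" (is "?Lx \<longleftrightarrow> ?Rx")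
   and "(y, w) \<in> conn (pattern_ends X Y) B \<longleftrightarrow>
     w = y \<or>
     w = a \<and> (Some C3 \<in> B \<or> Some C4 \<in> B \<and> (None \<in> B \<or> Some C1 \<in> B \<and> Some C2 \<in> B)) \<or>
     w = b \<and> (Some C4 \<in> B \<or> Some C3 \<in> B \<and> (None \<in> B \<or> Some C1 \<in> B \<and> Some C2 \<in> B)) \<or>
     w = x \<and> (Some C1 \<in> B \<and> Some C3 \<in> B \<or> Some C2 \<in> B \<and> Some C4 \<in> B \<or>
       None \<in> B \<and> (Some C1 \<in> B \<and> Some C4 \<in> B \<or> Some C2 \<in> B \<and> Some C3 \<in> B))" (is "?Ly \<longleftrightarrow> ?Ry")
proof -
  have dist: "x \<noteq> y" "x \<noteq> a" "x \<noteq> b" "y \<noteq> a" "y \<noteq> b" "a \<noteq> b"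
    using XY by (auto simp: x_def y_def a_def b_def glue_def)
  have pe: "pattern_ends X Y None = {a, b}" "pattern_ends X Y (Some C1) = {x, a}"
    "pattern_ends X Y (Some C2) = {x, b}" "pattern_ends X Y (Some C3) = {a, y}"
    "pattern_ends X Y (Some C4) = {b, y}"
    using XY by (auto simp: pattern_ends_def x_def y_def a_def b_def glue_def)
  define C where "C = (\<lambda>w. conn (pattern_ends X Y) B `` {w})"
  have C_iff: "(u, v) \<in> conn (pattern_ends X Y) B \<longleftrightarrow> C u = C v" for u v
    by (simp add: C_def conn_class_eq)
  have edge: "k \<in> B \<Longrightarrow> pattern_ends X Y k = {u, v} \<Longrightarrow> C u = C v" for k u v
    using conn_edge C_iff by metis
  have E: "None \<in> B \<Longrightarrow> C a = C b" "Some C1 \<in> B \<Longrightarrow> C x = C a" "Some C2 \<in> B \<Longrightarrow> C x = C b"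
    "Some C3 \<in> B \<Longrightarrow> C a = C y" "Some C4 \<in> B \<Longrightarrow> C b = C y"
    using edge pe by blast+
  show "?Lx \<longleftrightarrow> ?Rx"
  proof
    assume ?Lx
    then show ?Rx
    proof (induction rule: conn_induct)
      case (step u v k)
      show ?case
      proof (cases k)
        case None
        with step show ?thesis using dist by (auto simp: pe doubleton_eq_iff)
      next
        case (Some i)
        with step show ?thesis using dist by (cases i) (auto simp: pe doubleton_eq_iff)
      qed
    qed simp
  next
    assume ?Rx
    then show ?Lx unfolding C_iff using E by (elim disjE conjE) simp_all
  qed
  show "?Ly \<longleftrightarrow> ?Ry"
  proof
    assume ?Ly
    then show ?Ry
    proof (induction rule: conn_induct)
      case (step u v k)
      show ?case
      proof (cases k)
        case None
        with step show ?thesis using dist by (auto simp: pe doubleton_eq_iff)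
      next
        case (Some i)
        with step show ?thesis using dist by (cases i) (auto simp: pe doubleton_eq_iff)
      qed
    qed simp
  next
    assume ?Ry
    then show ?Ly unfolding C_iff using E by (elim disjE conjE) simp_all
  qed
qed

text \<open>With four vertices, \<open>2 + of_bool c\<close> is the least possible size. So these
  are the spanning trees of the pattern for \<open>c = True\<close> and its separating forests for
  \<open>c = False\<close>.\<close>

definition tight_patterns :: "vertex \<Rightarrow> vertex \<Rightarrow> bool \<Rightarrow> copy option set set" where
  "tight_patterns X Y c = {B.
     spanned (glue X Y C1 X) (glue X Y C3 Y) (pattern_verts X Y) (pattern_ends X Y) B \<and>
     ((glue X Y C1 X, glue X Y C3 Y) \<in> conn (pattern_ends X Y) B \<longleftrightarrow> c) \<and>
     card B = 2 + of_bool c}"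

text \<open>Encodes an edge set by five truth values, so that counting becomes a nested sum over
  \<open>bool\<close> with 32 terms, which simplification evaluates.\<close>

definition pattern_of :: "bool \<times> bool \<times> bool \<times> bool \<times> bool \<Rightarrow> copy option set" where
  "pattern_of = (\<lambda>(c1, c2, c3, c4, d). {k. case k of None \<Rightarrow> d
     | Some i \<Rightarrow> (case i of C1 \<Rightarrow> c1 | C2 \<Rightarrow> c2 | C3 \<Rightarrow> c3 | C4 \<Rightarrow> c4)})"

lemma bij_pattern_of: "bij pattern_of"
proof (rule bij_betw_byWitness[where
      f' = "\<lambda>B. (Some C1 \<in> B, Some C2 \<in> B, Some C3 \<in> B, Some C4 \<in> B, None \<in> B)"])
  show "\<forall>B\<in>UNIV. pattern_of (Some C1 \<in> B, Some C2 \<in> B, Some C3 \<in> B, Some C4 \<in> B, None \<in> B) = B"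
    by (auto simp: pattern_of_def split: option.splits copy.splits)
qed (auto simp: pattern_of_def)

lemma card_pattern: "card B = (\<Sum>i\<in>UNIV. of_bool (Some i \<in> B)) + of_bool (None \<in> B)"
  for B :: "copy option set"
proof -
  have "card B = (\<Sum>k\<in>UNIV. of_bool (k \<in> B))" by simp
  also have "\<dots> = (\<Sum>i\<in>UNIV. of_bool (Some i \<in> B)) + of_bool (None \<in> B)"
    unfolding UNIV_option_conv by (simp add: sum.reindex add.commute del: sum_of_bool_eq)
  finally show ?thesis .
qed

text \<open>Both counts come from the 16 spanning trees of the complete graph on four vertices,
  where by symmetry each edge lies in \<open>16 * 3 / 6 = 8\<close> of them. The edge missing from
  the pattern joins the outer special vertices: the trees avoiding it are counted for
  \<open>c = True\<close>, and those containing it, with that edge removed, for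
  \<open>c = False\<close>.\<close>

lemma card_tight_patterns:
  assumes "X \<noteq> Y"
  shows "card (tight_patterns X Y c) = 8"
proof -
  have "card (tight_patterns X Y c) = card (pattern_of -` tight_patterns X Y c)"
    using bij_pattern_of by (intro card_vimage_inj[symmetric]) (auto simp: bij_def)
  also have "\<dots> = (\<Sum>t\<in>UNIV. of_bool (pattern_of t \<in> tight_patterns X Y c))"
    by (simp add: vimage_def)
  also have "\<dots> = (\<Sum>c1\<in>UNIV. \<Sum>c2\<in>UNIV. \<Sum>c3\<in>UNIV. \<Sum>c4\<in>UNIV. \<Sum>d\<in>UNIV.
      of_bool (pattern_of (c1, c2, c3, c4, d) \<in> tight_patterns X Y c))"
    by (simp add: sum.cartesian_product del: sum_of_bool_eq)
  also have "\<dots> = 8"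
  proof -
    have sp: "pattern_of (c1, c2, c3, c4, d) \<in> tight_patterns X Y c \<longleftrightarrow>
      ((c1 \<or> c3 \<or> (c2 \<or> c4) \<and> d) \<and> (c2 \<or> c4 \<or> (c1 \<or> c3) \<and> d)) \<and>
      ((c1 \<and> c3 \<or> c2 \<and> c4 \<or> d \<and> (c1 \<and> c4 \<or> c2 \<and> c3)) \<longleftrightarrow> c) \<and>
      of_bool c1 + of_bool c2 + of_bool c3 + of_bool c4 + of_bool d = (2 + of_bool c :: nat)"
      for c1 c2 c3 c4 d
    proof -
      let ?B = "pattern_of (c1, c2, c3, c4, d)"
      have mem: "Some C1 \<in> ?B \<longleftrightarrow> c1" "Some C2 \<in> ?B \<longleftrightarrow> c2" "Some C3 \<in> ?B \<longleftrightarrow> c3"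
        "Some C4 \<in> ?B \<longleftrightarrow> c4" "None \<in> ?B \<longleftrightarrow> d"
        by (simp_all add: pattern_of_def)
      have dist: "glue X Y C1 X \<noteq> glue X Y C3 Y" "glue X Y C1 X \<noteq> glue X Y C1 Y"
        "glue X Y C1 X \<noteq> glue X Y C2 Y" "glue X Y C3 Y \<noteq> glue X Y C1 Y"
        "glue X Y C3 Y \<noteq> glue X Y C2 Y" "glue X Y C1 Y \<noteq> glue X Y C2 Y"
        using assms by (auto simp: glue_def)
      have "spanned (glue X Y C1 X) (glue X Y C3 Y) (pattern_verts X Y) (pattern_ends X Y) ?B \<longleftrightarrow>
        (\<forall>t\<in>pattern_verts X Y. (glue X Y C1 X, t) \<in> conn (pattern_ends X Y) ?B \<or>
          (glue X Y C3 Y, t) \<in> conn (pattern_ends X Y) ?B)"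
        unfolding spanned_def using conn_sym[of _ _ "pattern_ends X Y" ?B] by metis
      \<comment> \<open>Paths of three edges drop out: one from \<open>x\<close> to \<open>a\<close>
        through \<open>b\<close> and \<open>y\<close> ends with an edge that already joins
        \<open>a\<close> to \<open>y\<close>, and likewise for the others.\<close>
      also have "\<dots> \<longleftrightarrow> (c1 \<or> c3 \<or> (c2 \<or> c4) \<and> d) \<and> (c2 \<or> c4 \<or> (c1 \<or> c3) \<and> d)"
        unfolding pattern_conn_iff[OF assms] mem pattern_verts_def using dist dist[symmetric] by auto
      finally have 1: "spanned (glue X Y C1 X) (glue X Y C3 Y) (pattern_verts X Y)
          (pattern_ends X Y) ?B \<longleftrightarrow> (c1 \<or> c3 \<or> (c2 \<or> c4) \<and> d) \<and> (c2 \<or> c4 \<or> (c1 \<or> c3) \<and> d)" .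
      have 2: "(glue X Y C1 X, glue X Y C3 Y) \<in> conn (pattern_ends X Y) ?B \<longleftrightarrow>
        c1 \<and> c3 \<or> c2 \<and> c4 \<or> d \<and> (c1 \<and> c4 \<or> c2 \<and> c3)"
        unfolding pattern_conn_iff(1)[OF assms] mem using dist by simp
      show ?thesis
        unfolding tight_patterns_def mem_Collect_eq 1 2 card_pattern[of ?B] sum_copy mem by (rule refl)
    qed
    show ?thesis unfolding sp by (cases c) (simp_all add: UNIV_bool)
  qed
  finally show ?thesis .
qed

section \<open>The number of vertices\<close>

lemma verts_Gn_Suc: "verts (Gn (Suc n)) = (\<Union>i. glue (spX n) (spY n) i ` verts (Gn n))"
  by (simp add: Let_def)

lemma edges_Gn_Suc: "edges (Gn (Suc n)) = insert ENew (\<Union>i. ECopy i ` edges (Gn n))"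
  by (simp add: Let_def)

lemma ends_Gn_Suc: "ends (Gn (Suc n)) = glue_ends (spX n) (spY n) (ends (Gn n))"
  by (rule ext) (simp add: Let_def glue_ends_def split: edge.splits)

declare Gn.simps(2) [simp del]

text \<open>Each of the four identifications removes one vertex. With the representatives chosen by
  \<open>glue\<close>, the first copy keeps all its vertices, the second and third lose
  \<open>X\<close>, and the fourth loses both special vertices.\<close>

lemma card_glue_verts:
  assumes "finite V" "X \<in> V" "Y \<in> V" "X \<noteq> Y"
  shows "card (\<Union>i. glue X Y i ` V) + 4 = 4 * card V"
proof -
  have "(\<Union>i. glue X Y i ` V) = VCopy C1 ` V \<union> (VCopy C2 ` (V - {X}) \<union>
      (VCopy C3 ` (V - {X}) \<union> VCopy C4 ` (V - {X, Y})))" (is "_ = ?R")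
    using assms(2-4) unfolding UNIV_copy glue_def by (auto split: if_splits)
  moreover have "card ?R = card V + ((card V - 1) + ((card V - 1) + (card V - 2)))"
    using assms by (subst card_Un_disjoint, simp, simp, force)+
      (simp add: card_image inj_on_def card_Diff_subset)
  moreover have "card V \<ge> 2" using card_mono[of V "{X, Y}"] assms by simp
  ultimately show ?thesis by simp
qed

text \<open>The map v -> 4 v - 4 has the fixed point 4/3, and the distance from it, initially 2/3,
  is multiplied by 4 in each step. The factor 3 clears the denominators.\<close>

lemma card_verts_Gn: "3 * card (verts (Gn n)) = 2 * 4 ^ n + 4"
proof (induction n)
  case (Suc n)
  have "finite (verts (Gn n))" using wf_Gn by (rule wf_graph_finite)
  from card_glue_verts[OF this special_in_verts spX_neq_spY] Suc
  show ?case unfolding verts_Gn_Suc by simp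
qed simp

section \<open>Spanning trees and separating forests\<close>

text \<open>
  The spanning trees (\<open>c = True\<close>) and the spanning forests with two components that separate the
  special vertices (\<open>c = False\<close>).
\<close>

definition forests :: "nat \<Rightarrow> bool \<Rightarrow> edge set set" where
  "forests n c = {A. A \<subseteq> edges (Gn n) \<and> spanned (spX n) (spY n) (verts (Gn n)) (ends (Gn n)) A \<and>
     ((spX n, spY n) \<in> conn (ends (Gn n)) A \<longleftrightarrow> c) \<and> card A + 2 = card (verts (Gn n)) + of_bool c}"

lemma finite_edges_Gn: "finite (edges (Gn n))"
  using wf_Gn[of n] by (simp add: wf_graph_def)

lemma finite_forests: "finite (forests n c)"
  using finite_edges_Gn by (simp add: forests_def)

lemma E0_notin_edges_Suc: "A \<subseteq> edges (Gn (Suc n)) \<Longrightarrow> E0 \<notin> A"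
  by (auto simp: edges_Gn_Suc)

lemma edge_set_decompose:
  assumes "E0 \<notin> A"
  shows "A = (\<Union>i. ECopy i ` (ECopy i -` A)) \<union> (if ENew \<in> A then {ENew} else {})" (is "_ = ?R")
proof (rule set_eqI)
  fix e show "e \<in> A \<longleftrightarrow> e \<in> ?R" using assms by (cases e) auto
qed

lemma card_edge_set:
  assumes "finite A" "E0 \<notin> A"
  shows "card A = (\<Sum>i\<in>UNIV. card (ECopy i -` A)) + of_bool (ENew \<in> A)"
proof -
  have "card (\<Union>i. ECopy i ` (ECopy i -` A)) = (\<Sum>i\<in>UNIV. card (ECopy i ` (ECopy i -` A)))"
    using assms(1) by (intro card_UN_disjoint) auto
  also have "\<dots> = (\<Sum>i\<in>UNIV. card (ECopy i -` A))"
    by (intro sum.cong refl card_image) (auto intro: inj_onI)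
  finally have 1: "card (\<Union>i. ECopy i ` (ECopy i -` A)) = (\<Sum>i\<in>UNIV. card (ECopy i -` A))" .
  have "card A = card (\<Union>i. ECopy i ` (ECopy i -` A)) + card (if ENew \<in> A then {ENew} else {})"
    using assms(1) by (subst edge_set_decompose[OF assms(2)], intro card_Un_disjoint) auto
  then show ?thesis using 1 by simp
qed

text \<open>
  The lower bound on the size of a spanned set holds for the pattern and for each of the four
  parts. The cardinalities add up exactly, so the bound is attained in the glued graph if and only
  if it is attained in all of them.
\<close>

lemma forests_Suc_iff:
  assumes A: "A \<subseteq> edges (Gn (Suc n))"
  defines "B \<equiv> contract (spX n) (spY n) (ends (Gn n)) A"
  shows "A \<in> forests (Suc n) c \<longleftrightarrow>
    B \<in> tight_patterns (spX n) (spY n) c \<and> (\<forall>i. ECopy i -` A \<in> forests n (Some i \<in> B))"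
proof -
  let ?X = "spX n" and ?Y = "spY n" and ?V = "verts (Gn n)" and ?en = "ends (Gn n)"
  let ?P = "\<lambda>i. ECopy i -` A" and ?x = "glue (spX n) (spY n) C1 (spX n)"
    and ?y = "glue (spX n) (spY n) C3 (spY n)"
  have XY: "?X \<noteq> ?Y" by (rule spX_neq_spY)
  have E0: "E0 \<notin> A" using A by (rule E0_notin_edges_Suc)
  have fin: "finite A" using A finite_edges_Gn by (rule finite_subset)
  have sub: "?P i \<subseteq> edges (Gn n)" for i using A by (auto simp: edges_Gn_Suc)
  have conn_part: "(?X, ?Y) \<in> conn ?en (?P i) \<longleftrightarrow> Some i \<in> B" for i
    by (simp add: B_def contract_def)
  have new: "ENew \<in> A \<longleftrightarrow> None \<in> B" by (simp add: B_def contract_def)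
  have span: "spanned (spX (Suc n)) (spY (Suc n)) (verts (Gn (Suc n))) (ends (Gn (Suc n))) A \<longleftrightarrow>
      (\<forall>i. spanned ?X ?Y ?V ?en (?P i)) \<and>
      spanned ?x ?y (pattern_verts ?X ?Y) (pattern_ends ?X ?Y) B"
    using spanned_glue_iff[OF XY E0 special_in_verts, of ?en]
    by (simp only: verts_Gn_Suc ends_Gn_Suc spX.simps spY.simps B_def)
  have con: "(spX (Suc n), spY (Suc n)) \<in> conn (ends (Gn (Suc n))) A \<longleftrightarrow>
      (?x, ?y) \<in> conn (pattern_ends ?X ?Y) B"
    using conn_glue_iff_pattern[OF XY E0, of ?X ?Y C1 C3 ?en]
    by (simp add: ends_Gn_Suc B_def)
  have cV: "card (verts (Gn (Suc n))) + 4 = 4 * card ?V"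
    unfolding verts_Gn_Suc
    using card_glue_verts[OF wf_graph_finite[OF wf_Gn] special_in_verts XY] .
  have cA: "card A = card (?P C1) + card (?P C2) + card (?P C3) + card (?P C4) + of_bool (None \<in> B)"
    using card_edge_set[OF fin E0] by (simp only: sum_copy new)
  have cB: "card B = of_bool (Some C1 \<in> B) + of_bool (Some C2 \<in> B) + of_bool (Some C3 \<in> B) +
      of_bool (Some C4 \<in> B) + of_bool (None \<in> B)"
    using card_pattern[of B] by (simp only: sum_copy)
  show ?thesis
  proof
    assume "A \<in> forests (Suc n) c"
    then have *: "\<forall>i. spanned ?X ?Y ?V ?en (?P i)"
      "spanned ?x ?y (pattern_verts ?X ?Y) (pattern_ends ?X ?Y) B"
      "(?x, ?y) \<in> conn (pattern_ends ?X ?Y) B \<longleftrightarrow> c"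
      "card A + 2 = card (verts (Gn (Suc n))) + of_bool c"
      unfolding forests_def mem_Collect_eq span con by blast+
    have part: "card ?V + of_bool (Some i \<in> B) \<le> card (?P i) + 2" for i
      using spanned_card_bound[OF wf_Gn sub] *(1) unfolding spanned_def conn_part[symmetric] by blast
    have "2 + of_bool c \<le> card B"
      using pattern_card_bound[OF XY *(2)] *(3) by simp
    \<comment> \<open>The slacks in the bounds for the pattern and the four parts sum to zero: the
      terms for the copy edges cancel between \<open>card B\<close> and the parts, the term for the
      new edge between \<open>card A\<close> and \<open>card B\<close>. As no slack is negative, all
      of them vanish.\<close>
    then have eqs: "card B = 2 + of_bool c" "card (?P C1) + 2 = card ?V + of_bool (Some C1 \<in> B)"
      "card (?P C2) + 2 = card ?V + of_bool (Some C2 \<in> B)"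
      "card (?P C3) + 2 = card ?V + of_bool (Some C3 \<in> B)"
      "card (?P C4) + 2 = card ?V + of_bool (Some C4 \<in> B)"
      using part[of C1] part[of C2] part[of C3] part[of C4] *(4) cV cA cB by linarith+
    have "card (?P i) + 2 = card ?V + of_bool (Some i \<in> B)" for i
      using eqs(2-5) by (cases i) blast+
    then show "B \<in> tight_patterns ?X ?Y c \<and> (\<forall>i. ?P i \<in> forests n (Some i \<in> B))"
      unfolding forests_def tight_patterns_def mem_Collect_eq conn_part
      using *(1-3) eqs(1) sub by blast
  next
    assume R: "B \<in> tight_patterns ?X ?Y c \<and> (\<forall>i. ?P i \<in> forests n (Some i \<in> B))"
    then have *: "spanned ?x ?y (pattern_verts ?X ?Y) (pattern_ends ?X ?Y) B"
      "(?x, ?y) \<in> conn (pattern_ends ?X ?Y) B \<longleftrightarrow> c" "card B = 2 + of_bool c"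
      unfolding tight_patterns_def by blast+
    have part: "spanned ?X ?Y ?V ?en (?P i)" "card (?P i) + 2 = card ?V + of_bool (Some i \<in> B)" for i
      using R unfolding forests_def by blast+
    have "card A + 2 = card (verts (Gn (Suc n))) + of_bool c"
      using part(2)[of C1] part(2)[of C2] part(2)[of C3] part(2)[of C4] *(3) cV cA cB by linarith
    then show "A \<in> forests (Suc n) c"
      unfolding forests_def mem_Collect_eq span con using A *(1,2) part(1) by blast
  qed
qed

section \<open>Reassembling and counting\<close>

definition assemble :: "copy option set \<Rightarrow> (copy \<Rightarrow> edge set) \<Rightarrow> edge set" where
  "assemble B P = (\<Union>i. ECopy i ` P i) \<union> (if None \<in> B then {ENew} else {})"

lemma assemble_part [simp]: "ECopy i -` assemble B P = P i"
  by (auto simp: assemble_def)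

lemma ENew_in_assemble: "ENew \<in> assemble B P \<longleftrightarrow> None \<in> B"
  by (auto simp: assemble_def)

lemma assemble_subset:
  assumes "\<And>i. P i \<in> forests n (Some i \<in> B)"
  shows "assemble B P \<subseteq> edges (Gn (Suc n))"
  using assms unfolding assemble_def edges_Gn_Suc forests_def by auto

text \<open>Assembling takes only the new edge from \<open>B\<close>; the copy edges of
  \<open>B\<close> are read off from which parts connect the special vertices. Hence the pattern can
  be recovered from the assembled set.\<close>

lemma contract_assemble:
  assumes "\<And>i. P i \<in> forests n (Some i \<in> B)"
  shows "contract (spX n) (spY n) (ends (Gn n)) (assemble B P) = B"
proof (rule set_eqI)
  fix k
  have "(spX n, spY n) \<in> conn (ends (Gn n)) (P i) \<longleftrightarrow> Some i \<in> B" for i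
    using assms[of i] unfolding forests_def by blast
  then show "k \<in> contract (spX n) (spY n) (ends (Gn n)) (assemble B P) \<longleftrightarrow> k \<in> B"
    by (cases k) (simp_all add: contract_def ENew_in_assemble)
qed

lemma forests_Suc:
  "forests (Suc n) c = (\<Union>B\<in>tight_patterns (spX n) (spY n) c.
     assemble B ` (\<Pi>\<^sub>E i\<in>UNIV. forests n (Some i \<in> B)))" (is "_ = ?R")
proof (intro equalityI subsetI)
  fix A assume A: "A \<in> forests (Suc n) c"
  let ?B = "contract (spX n) (spY n) (ends (Gn n)) A"
  have sub: "A \<subseteq> edges (Gn (Suc n))" using A by (simp add: forests_def)
  have "ENew \<in> A \<longleftrightarrow> None \<in> ?B" by (simp add: contract_def)
  then have "A = assemble ?B (\<lambda>i. ECopy i -` A)"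
    using edge_set_decompose[OF E0_notin_edges_Suc[OF sub]] by (simp add: assemble_def)
  moreover have "(\<lambda>i. ECopy i -` A) \<in> (\<Pi>\<^sub>E i\<in>UNIV. forests n (Some i \<in> ?B))"
    "?B \<in> tight_patterns (spX n) (spY n) c"
    using A forests_Suc_iff[OF sub, of c] by (auto simp: PiE_iff)
  ultimately show "A \<in> ?R" by blast
next
  fix A assume "A \<in> ?R"
  then obtain B P where B: "B \<in> tight_patterns (spX n) (spY n) c" "A = assemble B P"
    and P: "P i \<in> forests n (Some i \<in> B)" for i by (auto simp: PiE_iff)
  show "A \<in> forests (Suc n) c"
    unfolding B(2) forests_Suc_iff[OF assemble_subset[OF P]] contract_assemble[OF P]
    using B(1) P by simp
qed

text \<open>Different patterns give disjoint families, as \<open>contract\<close> recovers the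
  pattern. For a fixed pattern the parts recover the chosen family, so the choices in the four
  copies multiply.\<close>

lemma card_forests_Suc:
  "card (forests (Suc n) c) = (\<Sum>B\<in>tight_patterns (spX n) (spY n) c.
     \<Prod>i\<in>UNIV. card (forests n (Some i \<in> B)))"
proof -
  let ?F = "\<lambda>B. \<Pi>\<^sub>E i\<in>UNIV. forests n (Some i \<in> B)"
  have fin: "finite (?F B)" for B :: "copy option set"
    by (intro finite_PiE finite_forests) simp
  have "card (forests (Suc n) c) = (\<Sum>B\<in>tight_patterns (spX n) (spY n) c. card (assemble B ` ?F B))"
    unfolding forests_Suc
  proof (intro card_UN_disjoint ballI impI)
    have con: "contract (spX n) (spY n) (ends (Gn n)) A = B" if "A \<in> assemble B ` ?F B" for A B
      using that contract_assemble by (elim imageE) (simp add: PiE_iff)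
    fix B B' :: "copy option set" assume "B \<noteq> B'"
    then show "assemble B ` ?F B \<inter> assemble B' ` ?F B' = {}"
      using con[of _ B] con[of _ B'] by (metis disjoint_iff)
  next
    fix B show "finite (assemble B ` ?F B)" using fin by (rule finite_imageI)
  qed simp
  also have "\<dots> = (\<Sum>B\<in>tight_patterns (spX n) (spY n) c. \<Prod>i\<in>UNIV. card (forests n (Some i \<in> B)))"
  proof (intro sum.cong refl)
    fix B :: "copy option set"
    have "inj_on (assemble B) (?F B)"
      by (intro inj_onI ext) (metis assemble_part)
    then show "card (assemble B ` ?F B) = (\<Prod>i\<in>UNIV. card (forests n (Some i \<in> B)))"
      by (simp add: card_image card_PiE)
  qed
  finally show ?thesis .
qed

lemma forests_0: "forests 0 c = (if c then {{E0}} else {{}})"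
proof -
  have XY: "(X0, Y0) \<in> conn (\<lambda>_. {X0, Y0}) {E0}" by (rule conn_edge[of E0]) simp_all
  have "A \<in> forests 0 c \<longleftrightarrow> A = (if c then {E0} else {})" for A
  proof -
    consider "A = {}" | "A = {E0}" | "\<not> A \<subseteq> {E0}" by blast
    then show ?thesis
    proof cases
      case 1
      then show ?thesis by (simp add: forests_def spanned_def conn_empty)
    next
      case 2
      then show ?thesis using XY by (simp add: forests_def spanned_def)
    next
      case 3
      then show ?thesis by (auto simp: forests_def)
    qed
  qed
  then show ?thesis by auto
qed

lemma card_forests: "card (forests n c) = 2 ^ (4 ^ n - 1)"
proof (induction n arbitrary: c)
  case 0
  show ?case by (simp add: forests_0)
next
  case (Suc n)
  have "card (forests (Suc n) c) = 8 * (2 ^ (4 ^ n - 1)) ^ 4"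
    unfolding card_forests_Suc Suc.IH
    by (simp add: card_tight_patterns[OF spX_neq_spY] UNIV_copy eval_nat_numeral)
  \<comment> \<open>The exponents follow m -> 4 m + 3, so m + 1 is multiplied by 4.\<close>
  also have "\<dots> = 2 ^ (3 + 4 * (4 ^ n - 1))"
    by (simp only: power_add power_mult[symmetric] mult.commute) simp
  also have "3 + 4 * (4 ^ n - 1) = (4 ^ Suc n - 1 :: nat)"
    by (simp add: diff_mult_distrib2)
  finally show ?case .
qed

section \<open>Spanning trees and the growth constant\<close>

lemma is_tree_Gn_iff:
  assumes "A \<subseteq> edges (Gn n)"
  shows "is_tree (Gn n\<lparr>edges := A\<rparr>) \<longleftrightarrow> A \<in> forests n True"
proof -
  let ?R = "conn (ends (Gn n)) A"
  have "connected_graph (Gn n\<lparr>edges := A\<rparr>) \<longleftrightarrow>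
      spanned (spX n) (spY n) (verts (Gn n)) (ends (Gn n)) A \<and> (spX n, spY n) \<in> ?R"
  proof
    assume "connected_graph (Gn n\<lparr>edges := A\<rparr>)"
    then show "spanned (spX n) (spY n) (verts (Gn n)) (ends (Gn n)) A \<and> (spX n, spY n) \<in> ?R"
      using special_in_verts unfolding connected_graph_def adjacency_rtrancl spanned_def by simp
  next
    assume R: "spanned (spX n) (spY n) (verts (Gn n)) (ends (Gn n)) A \<and> (spX n, spY n) \<in> ?R"
    have "(z, spX n) \<in> ?R" if "z \<in> verts (Gn n)" for z
      using R that conn_trans[OF _ conn_sym, of z "spY n"] unfolding spanned_def by blast
    then have "(u, v) \<in> ?R" if "u \<in> verts (Gn n)" "v \<in> verts (Gn n)" for u v
      using that conn_trans[OF _ conn_sym, of u "spX n" _ _ v] by blast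
    then show "connected_graph (Gn n\<lparr>edges := A\<rparr>)"
      using special_in_verts(1)[of n] unfolding connected_graph_def adjacency_rtrancl by auto
  qed
  then show ?thesis
    using assms by (auto simp: is_tree_iff[OF wf_graph_spanning_subgraph[OF wf_Gn assms]] forests_def)
qed

lemma num_spanning_trees_Gn: "num_spanning_trees (Gn n) = 2 ^ (4 ^ n - 1)"
proof -
  have "{H \<in> spanning_subgraphs (Gn n). is_tree H} = (\<lambda>A. Gn n\<lparr>edges := A\<rparr>) ` forests n True"
    using is_tree_Gn_iff[of _ n] by (auto simp: spanning_subgraphs_def forests_def)
  moreover have "inj_on (\<lambda>A. Gn n\<lparr>edges := A\<rparr>) (forests n True)"
    using inj_spanning_subgraph by (rule inj_on_subset) simp
  ultimately show ?thesis
    by (simp add: num_spanning_trees_def card_image card_forests)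
qed

text \<open>The count is positive, so a spanning tree exists, and the remaining edges only add
  connections.\<close>

lemma connected_Gn: "connected_graph (Gn n)"
proof -
  have "forests n True \<noteq> {}" using card_forests[of n True] by force
  then obtain A where A: "A \<subseteq> edges (Gn n)" "is_tree (Gn n\<lparr>edges := A\<rparr>)"
    using is_tree_Gn_iff[of _ n] by (auto simp: forests_def)
  then show ?thesis
    using conn_mono[OF A(1), of "ends (Gn n)"]
    unfolding is_tree_def connected_graph_def adjacency_rtrancl by auto
qed

text \<open>The tolerance is half a unit in the fourth decimal place; \<open>5\<close> is the
  truncation order of the series behind \<open>ln_approx_bounds\<close>.\<close>

lemma ln_2_approx: "\<bar>3 / 2 * ln 2 - (1.0397 :: real)\<bar> < 0.00005"
  using ln_approx_bounds[of 2 5] by (simp add: eval_nat_numeral abs_less_iff)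

theorem corollary5:
  shows "(\<forall>n. real (num_spanning_trees (Gn n)) = tutte (Gn n) (1::real) 1
        \<and> num_spanning_trees (Gn n) = 8 ^ ((4 ^ n - 1) div 3)
        \<and> num_spanning_trees (Gn n) = 2 ^ (4 ^ n - 1))
    \<and> (\<lambda>n. ln (real (num_spanning_trees (Gn n))) / real (card (verts (Gn n))))
        \<longlonglongrightarrow> 3 / 2 * ln 2
    \<and> \<bar>3 / 2 * ln 2 - (1.0397 :: real)\<bar> < 0.00005"
proof (intro conjI allI ln_2_approx)
  fix n
  show "real (num_spanning_trees (Gn n)) = tutte (Gn n) (1::real) 1"
    by (simp add: tutte_1_1[OF wf_Gn connected_Gn])
  show "num_spanning_trees (Gn n) = 2 ^ (4 ^ n - 1)" by (rule num_spanning_trees_Gn)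
  have "(2 :: nat) ^ (4 ^ n - 1) = 2 ^ (3 * ((4 ^ n - 1) div 3))"
    using three_dvd[of n] by simp
  then show "num_spanning_trees (Gn n) = 8 ^ ((4 ^ n - 1) div 3)"
    by (simp add: num_spanning_trees_Gn power_mult)
next
  \<comment> \<open>Cancelling \<open>4 ^ n\<close> leaves only the null sequence
    \<open>(1 / 4) ^ n\<close>. The factor 3/2 is the inverse of the leading coefficient 2/3 of the
    vertex count.\<close>
  have "(\<lambda>n. ln (real (num_spanning_trees (Gn n))) / real (card (verts (Gn n)))) =
    (\<lambda>n. (3 / 2 * ln 2) * ((1 - (1 / 4) ^ n) / (1 + 2 * (1 / 4) ^ n)))"
  proof
    fix n
    have 1: "real (card (verts (Gn n))) = 2 / 3 * (4 ^ n + 2)"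
      using arg_cong[OF card_verts_Gn[of n], of real] by simp
    have 2: "ln (real (num_spanning_trees (Gn n))) = (4 ^ n - 1) * ln 2"
      by (simp add: num_spanning_trees_Gn ln_realpow of_nat_diff)
    have 3: "(1 - (1 / 4) ^ n) / (1 + 2 * (1 / 4) ^ n) = (4 ^ n - 1) / (4 ^ n + 2 :: real)"
    proof -
      have "1 - (1 / 4) ^ n = (4 ^ n - 1) / (4 ^ n :: real)"
        "1 + 2 * (1 / 4) ^ n = (4 ^ n + 2) / (4 ^ n :: real)"
        by (simp_all add: power_one_over field_simps)
      then show ?thesis by simp
    qed
    show "ln (real (num_spanning_trees (Gn n))) / real (card (verts (Gn n))) =
        (3 / 2 * ln 2) * ((1 - (1 / 4) ^ n) / (1 + 2 * (1 / 4) ^ n))"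
      unfolding 1 2 3 by simp
  qed
  moreover have "(\<lambda>n. (3 / 2 * ln 2) * ((1 - (1 / 4) ^ n) / (1 + 2 * (1 / 4 :: real) ^ n)))
      \<longlonglongrightarrow> (3 / 2 * ln 2) * ((1 - 0) / (1 + 2 * 0))"
    by (intro tendsto_intros LIMSEQ_realpow_zero) simp_all
  ultimately show "(\<lambda>n. ln (real (num_spanning_trees (Gn n))) / real (card (verts (Gn n))))
      \<longlonglongrightarrow> 3 / 2 * ln 2"
    by simp
qed

end
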